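(* Let $M$ be an infinite pointed metric space and let $X$ be a non-zero Banach space. Assume that the pair $(M,X^* )$ has the contraction-extension property (CPE). If $M$ is unbounded or $M$ is not uniformly discrete, then the norm on $\mathcal F(M,X)$ is octahedral. Consequently, the unit ball of $\mathcal F(M,X)$ cannot have any point of Fréchet differentiability.
   Context: All Banach spaces are real; $B_X$ and $S_X$ denote the closed unit ball and unit sphere of $X$. A pointed metric space is a metric space $M$ with a designated point $0\in M$. $M$ is uniformly discrete if $\inf\{d(x,y): x,y\in M,\ x\neq y\}>0$. For a Banach space $Z$, $Lip(M,Z)$ is the Banach space of all Lipschitz functions $f:M\to Z$ with $f(0)=0$, with norm $\|f\|=\sup\{\|f(x)-f(y)\|/d(x,y): x,y\in M,\ x\ne y\}$. For $m\in M$ and $x\in X$, let $\delta_{m,x}\in Lip(M,X^* )^*$ be given by $\delta_{m,x}(f)=f(m)(x)$. The vector-valued Lipschitz-free space is $\mathcal F(M,X):=\overline{\mathrm{span}}\{\delta_{m,x}: m\in M, x\in X\}$, the norm closure being taken in $Lip(M,X^* )^*$; it satisfies $\mathcal F(M,X)^*=Lip(M,X^* )$ isometrically, via evaluation. Contraction-extension property: for a metric space $M$ and a Banach space $Z$, the pair $(M,Z)$ has the CPE if for every $N\subseteq M$ and every Lipschitz function $f:N\to Z$ there exists a Lipschitz function $F:M\to Z$ extending $f$ with $\|F\|_{Lip(M,Z)}=\|f\|_{Lip(N,Z)}$, where these norms denote the best Lipschitz constants on $M$ and on $N$ respectively. The norm of a Banach space $E$ is octahedral if for every $\varepsilon>0$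 and every finite-dimensional subspace $V\subseteq E$ there is $y\in S_E$ such that $\|x+\lambda y\|\ge(1-\varepsilon)(\|x\|+|\lambda|)$ for every $x\in V$ and every scalar $\lambda$. A point $x$ of a Banach space $E$ is a point of Fréchet differentiability if the limit $\lim_{t\to0}\frac{\|x+th\|-\|x\|}{t}$ exists uniformly for $h\in S_E$ and defines a continuous linear functional of $h\in E$. *)

theory Defs
  imports "HOL-Analysis.Analysis"
begin

class pointed_metric_space = metric_space +
  fixes base_point :: 'a

text \<open>The supremum is taken over the difference quotients together with \<open>0\<close>, so that it is also
  meaningful (and equal to \<open>0\<close>) when \<open>S\<close> has at most one point; \<open>Sup {}\<close> is unspecified in the reals.\<close>

definition lip_const :: "'a::metric_space set \<Rightarrow> ('a \<Rightarrow> 'b::real_normed_vector) \<Rightarrow> real" where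
  "lip_const S f =
     Sup (insert 0 {norm (f x - f y) / dist x y | x y. x \<in> S \<and> y \<in> S \<and> x \<noteq> y})"

definition CPE :: "'a::metric_space set \<Rightarrow> 'b::real_normed_vector itself \<Rightarrow> bool" where
  "CPE M (_ :: 'b itself) \<longleftrightarrow>
     (\<forall>N f. N \<subseteq> M \<and> (\<exists>L. L-lipschitz_on N (f :: 'a \<Rightarrow> 'b)) \<longrightarrow>
        (\<exists>F. (\<exists>L. L-lipschitz_on M F) \<and> (\<forall>x\<in>N. F x = f x) \<and> lip_const M F = lip_const N f))"

lemma lip_const_le:
  assumes "L-lipschitz_on S f"
  shows "lip_const S f \<le> L"
  unfolding lip_const_def
proof (rule cSup_least)
  fix r assume "r \<in> insert 0 {norm (f x - f y) / dist x y | x y. x \<in> S \<and> y \<in> S \<and> x \<noteq> y}"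
  then show "r \<le> L"
    using assms by (auto simp: lipschitz_on_def dist_norm divide_le_eq)
qed simp

lemma lipschitz_on_lip_const:
  assumes "L-lipschitz_on S f"
  shows "(lip_const S f)-lipschitz_on S f"
proof -
  let ?Q = "insert 0 {norm (f x - f y) / dist x y | x y. x \<in> S \<and> y \<in> S \<and> x \<noteq> y}"
  have bdd: "bdd_above ?Q"
    using assms
    by (intro bdd_aboveI[of _ L]) (auto simp: lipschitz_on_def dist_norm divide_le_eq)
  have up: "r \<le> lip_const S f" if "r \<in> ?Q" for r
    unfolding lip_const_def using that bdd by (rule cSup_upper)
  show ?thesis
  proof (rule lipschitz_onI)
    fix x y assume xy: "x \<in> S" "y \<in> S"
    show "dist (f x) (f y) \<le> lip_const S f * dist x y"
    proof (cases "x = y")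
      case False
      then have "norm (f x - f y) / dist x y \<le> lip_const S f"
        using xy by (intro up) auto
      with False show ?thesis
        by (simp add: dist_norm divide_le_eq)
    qed simp
  qed (rule up, simp)
qed

typedef (overloaded) ('m, 'z) lip =
    "{f :: 'm::pointed_metric_space \<Rightarrow> 'z::real_normed_vector.
        f base_point = 0 \<and> (\<exists>L. L-lipschitz_on UNIV f)}"
  morphisms lip_apply Abs_lip
  by (rule exI[of _ "\<lambda>_. 0"]) (auto intro: lipschitz_on_constant)

setup_lifting type_definition_lip

instantiation lip :: (pointed_metric_space, real_normed_vector) real_normed_vector
begin

lift_definition norm_lip :: "('a, 'b) lip \<Rightarrow> real" is "lip_const UNIV" .

lift_definition zero_lip :: "('a, 'b) lip" is "\<lambda>_. 0"
  by (auto intro: lipschitz_on_constant)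

lift_definition plus_lip :: "('a, 'b) lip \<Rightarrow> ('a, 'b) lip \<Rightarrow> ('a, 'b) lip" is "\<lambda>f g x. f x + g x"
  by (auto intro: lipschitz_on_add)

lift_definition minus_lip :: "('a, 'b) lip \<Rightarrow> ('a, 'b) lip \<Rightarrow> ('a, 'b) lip" is "\<lambda>f g x. f x - g x"
  by (auto intro: lipschitz_on_diff)

lift_definition uminus_lip :: "('a, 'b) lip \<Rightarrow> ('a, 'b) lip" is "\<lambda>f x. - f x"
  by (auto simp: lipschitz_on_minus_iff)

lift_definition scaleR_lip :: "real \<Rightarrow> ('a, 'b) lip \<Rightarrow> ('a, 'b) lip" is "\<lambda>r f x. r *\<^sub>R f x"
  by (auto intro: lipschitz_on_cmult)

definition dist_lip :: "('a, 'b) lip \<Rightarrow> ('a, 'b) lip \<Rightarrow> real" where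
  "dist_lip f g = norm (f - g)"

definition uniformity_lip :: "(('a, 'b) lip \<times> ('a, 'b) lip) filter" where
  "uniformity_lip = (INF e\<in>{0<..}. principal {(f, g). dist f g < e})"

definition open_lip :: "('a, 'b) lip set \<Rightarrow> bool" where
  "open_lip S = (\<forall>f\<in>S. \<forall>\<^sub>F (f', g) in uniformity. f' = f \<longrightarrow> g \<in> S)"

definition sgn_lip :: "('a, 'b) lip \<Rightarrow> ('a, 'b) lip" where
  "sgn_lip f = inverse (norm f) *\<^sub>R f"

instance
proof
  fix f g :: "('a, 'b) lip" and r :: real
  show "(norm f = 0) = (f = 0)"
  proof transfer
    fix f :: "'a \<Rightarrow> 'b"
    assume *: "f base_point = 0 \<and> (\<exists>L. L-lipschitz_on UNIV f)"
    show "(lip_const UNIV f = 0) = (f = (\<lambda>_. 0))"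
    proof
      assume "lip_const UNIV f = 0"
      then have "0-lipschitz_on UNIV f"
        using * lipschitz_on_lip_const by metis
      then have "f x = f base_point" for x
        using lipschitz_onD[of 0 UNIV f x base_point] by simp
      with * show "f = (\<lambda>_. 0)" by auto
    next
      assume f: "f = (\<lambda>_. 0)"
      have "lip_const UNIV f \<le> 0"
        unfolding f by (rule lip_const_le) (rule lipschitz_on_constant)
      moreover have "0 \<le> lip_const UNIV f"
        using * lipschitz_on_lip_const lipschitz_on_nonneg by metis
      ultimately show "lip_const UNIV f = 0" by simp
    qed
  qed
  show "norm (f + g) \<le> norm f + norm g"
    by transfer (metis lip_const_le lipschitz_on_add lipschitz_on_lip_const)
  have le: "norm (r *\<^sub>R f) \<le> \<bar>r\<bar> * norm f" for r and f :: "('a, 'b) lip"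
    by transfer (metis lip_const_le lipschitz_on_cmult lipschitz_on_lip_const)
  show "norm (r *\<^sub>R f) = \<bar>r\<bar> * norm f"
  proof (cases "r = 0")
    case True
    have "0 \<le> norm (r *\<^sub>R f)"
      by transfer (metis lipschitz_on_cmult lipschitz_on_lip_const lipschitz_on_nonneg)
    with le[of r f] True show ?thesis by simp
  next
    case False
    have "inverse r *\<^sub>R (r *\<^sub>R f) = f"
      using False by (transfer, auto)
    then have "norm f \<le> \<bar>inverse r\<bar> * norm (r *\<^sub>R f)"
      using le[of "inverse r" "r *\<^sub>R f"] by simp
    then have "\<bar>r\<bar> * norm f \<le> norm (r *\<^sub>R f)"
      using False by (simp add: field_simps)
    with le[of r f] show ?thesis by simp
  qed
qed (unfold dist_lip_def open_lip_def sgn_lip_def uniformity_lip_def,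
     (rule refl | (transfer, force simp: algebra_simps))+)

end

lemma lipschitz_on_lip_apply: "(norm f)-lipschitz_on UNIV (lip_apply f)"
  by transfer (auto intro: lipschitz_on_lip_const)

lemma norm_lip_apply: "norm (lip_apply f x) \<le> norm f * dist x base_point"
proof -
  have "lip_apply f base_point = 0"
    by transfer simp
  then show ?thesis
    using lipschitz_onD[OF lipschitz_on_lip_apply, of x base_point f] by simp
qed

instance lip :: (pointed_metric_space, banach) banach
proof
  fix X :: "nat \<Rightarrow> ('a, 'b) lip"
  assume X: "Cauchy X"
  have diff: "lip_apply (f - g) x = lip_apply f x - lip_apply g x"
    for f g :: "('a, 'b) lip" and x
    by transfer simp
  have base: "lip_apply f base_point = 0" for f :: "('a, 'b) lip"
    by transfer simp
  have "\<exists>l. (\<lambda>n. lip_apply (X n) x) \<longlonglongrightarrow> l" for x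
  proof -
    have "Cauchy (\<lambda>n. lip_apply (X n) x)"
    proof (rule CauchyI)
      fix e :: real assume "0 < e"
      define d where "d = e / (dist x base_point + 1)"
      have pos: "0 < dist x base_point + 1"
        using zero_le_dist[of x base_point] by linarith
      have "0 < d" using \<open>0 < e\<close> pos by (simp add: d_def)
      from CauchyD[OF X this] obtain K
        where K: "\<And>m n. m \<ge> K \<Longrightarrow> n \<ge> K \<Longrightarrow> norm (X m - X n) < d" by auto
      show "\<exists>K. \<forall>m\<ge>K. \<forall>n\<ge>K. norm (lip_apply (X m) x - lip_apply (X n) x) < e"
      proof (intro exI allI impI)
        fix m n assume "K \<le> m" "K \<le> n"
        have "norm (lip_apply (X m) x - lip_apply (X n) x) \<le> norm (X m - X n) * dist x base_point"
          using norm_lip_apply[of "X m - X n" x] by (simp add: diff)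
        also have "\<dots> \<le> d * dist x base_point"
          using K[OF \<open>K \<le> m\<close> \<open>K \<le> n\<close>] by (intro mult_right_mono) auto
        also have "\<dots> < d * (dist x base_point + 1)"
          using \<open>0 < d\<close> by simp
        also have "\<dots> = e" using pos by (simp add: d_def)
        finally show "norm (lip_apply (X m) x - lip_apply (X n) x) < e" .
      qed
    qed
    then show ?thesis
      by (simp add: Cauchy_convergent_iff convergent_def)
  qed
  then obtain v where v: "\<And>x. (\<lambda>n. lip_apply (X n) x) \<longlonglongrightarrow> v x"
    by metis
  have near: "\<exists>K. \<forall>n\<ge>K. e-lipschitz_on UNIV (\<lambda>x. lip_apply (X n) x - v x)" if e: "0 < e" for e
  proof -
    from CauchyD[OF X e] obtain K
      where K: "\<And>m n. m \<ge> K \<Longrightarrow> n \<ge> K \<Longrightarrow> norm (X m - X n) < e" by auto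
    have "e-lipschitz_on UNIV (\<lambda>x. lip_apply (X n) x - v x)" if n: "n \<ge> K" for n
    proof (rule lipschitz_onI)
      fix x y
      have lim: "(\<lambda>m. dist (lip_apply (X n) x - lip_apply (X m) x) (lip_apply (X n) y - lip_apply (X m) y))
          \<longlonglongrightarrow> dist (lip_apply (X n) x - v x) (lip_apply (X n) y - v y)"
        by (intro tendsto_intros v)
      show "dist (lip_apply (X n) x - v x) (lip_apply (X n) y - v y) \<le> e * dist x y"
      proof (rule LIMSEQ_le_const2[OF lim], intro exI allI impI)
        fix m assume m: "K \<le> m"
        have "dist (lip_apply (X n - X m) x) (lip_apply (X n - X m) y) \<le> norm (X n - X m) * dist x y"
          by (rule lipschitz_onD[OF lipschitz_on_lip_apply]) auto
        also have "\<dots> \<le> e * dist x y"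
          using K[OF n m] by (intro mult_right_mono) auto
        finally show "dist (lip_apply (X n) x - lip_apply (X m) x)
            (lip_apply (X n) y - lip_apply (X m) y) \<le> e * dist x y"
          by (simp add: diff)
      qed
    qed (use e in simp)
    then show ?thesis by blast
  qed
  obtain k where "1-lipschitz_on UNIV (\<lambda>x. lip_apply (X k) x - v x)"
    using near[of 1] by auto
  from lipschitz_on_diff[OF lipschitz_on_lip_apply[of "X k"] this]
  have "\<exists>L. L-lipschitz_on UNIV v" by auto
  moreover have "v base_point = 0"
    using v[of base_point] by (simp add: base LIMSEQ_const_iff)
  ultimately have app: "lip_apply (Abs_lip v) = v"
    by (simp add: Abs_lip_inverse)
  have "X \<longlonglongrightarrow> Abs_lip v"
  proof (rule LIMSEQ_I)
    fix e :: real assume "0 < e"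
    then obtain K where K: "\<And>n. n \<ge> K \<Longrightarrow> (e/2)-lipschitz_on UNIV (\<lambda>x. lip_apply (X n) x - v x)"
      using near[of "e/2"] by auto
    have "norm (X n - Abs_lip v) \<le> e/2" if "n \<ge> K" for n
      using lip_const_le[OF K[OF that]] by (simp add: norm_lip.rep_eq minus_lip.rep_eq app)
    then show "\<exists>K. \<forall>n\<ge>K. norm (X n - Abs_lip v) < e"
      using \<open>0 < e\<close> by (intro exI[of _ K]) force
  qed
  then show "convergent X"
    by (auto simp: convergent_def)
qed

lemma bounded_linear_lip_eval:
  fixes m :: "'m::pointed_metric_space" and x :: "'x::real_normed_vector"
  shows "bounded_linear (\<lambda>f :: ('m, 'x \<Rightarrow>\<^sub>L real) lip. blinfun_apply (lip_apply f m) x)"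
proof (rule bounded_linear_intro[where K = "dist m base_point * norm x"])
  fix f g :: "('m, 'x \<Rightarrow>\<^sub>L real) lip" and r :: real
  show "blinfun_apply (lip_apply (f + g) m) x
      = blinfun_apply (lip_apply f m) x + blinfun_apply (lip_apply g m) x"
    by (simp add: plus_lip.rep_eq blinfun.add_left)
  show "blinfun_apply (lip_apply (r *\<^sub>R f) m) x = r *\<^sub>R blinfun_apply (lip_apply f m) x"
    by (simp add: scaleR_lip.rep_eq blinfun.scaleR_left)
  have "norm (blinfun_apply (lip_apply f m) x) \<le> norm (lip_apply f m) * norm x"
    by (rule norm_blinfun)
  also have "\<dots> \<le> norm f * dist m base_point * norm x"
    by (intro mult_right_mono norm_lip_apply) simp
  finally show "norm (blinfun_apply (lip_apply f m) x) \<le> norm f * (dist m base_point * norm x)"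
    by (simp add: mult.assoc)
qed

lift_definition delta ::
    "'m::pointed_metric_space \<Rightarrow> 'x::real_normed_vector \<Rightarrow> ('m, 'x \<Rightarrow>\<^sub>L real) lip \<Rightarrow>\<^sub>L real"
  is "\<lambda>m x f. blinfun_apply (lip_apply f m) x"
  by (rule bounded_linear_lip_eval)

typedef (overloaded) ('m, 'x) lip_free =
    "closure (span {delta m x | m x. True})
       :: (('m::pointed_metric_space, 'x::real_normed_vector \<Rightarrow>\<^sub>L real) lip \<Rightarrow>\<^sub>L real) set"
  morphisms lip_free_functional Abs_lip_free
  using closure_subset span_zero by blast

setup_lifting type_definition_lip_free

lemma subspace_closure_span: "subspace (closure (span S))"
  for S :: "'e::real_normed_vector set"
proof (rule subspaceI)
  show "0 \<in> closure (span S)"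
    using closure_subset span_zero by blast
next
  fix u v assume "u \<in> closure (span S)" "v \<in> closure (span S)"
  then obtain a b where "\<And>n. a n \<in> span S" "a \<longlonglongrightarrow> u" "\<And>n. b n \<in> span S" "b \<longlonglongrightarrow> v"
    unfolding closure_sequential by metis
  then have "(\<lambda>n. a n + b n) \<longlonglongrightarrow> u + v" "\<And>n. a n + b n \<in> span S"
    by (auto intro: tendsto_add span_add)
  then show "u + v \<in> closure (span S)"
    unfolding closure_sequential by (intro exI[of _ "\<lambda>n. a n + b n"]) auto
next
  fix c u assume "u \<in> closure (span S)"
  then obtain a where "\<And>n. a n \<in> span S" "a \<longlonglongrightarrow> u"
    unfolding closure_sequential by metis
  then have "(\<lambda>n. c *\<^sub>R a n) \<longlonglongrightarrow> c *\<^sub>R u" "\<And>n. c *\<^sub>R a n \<in> span S"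
    by (auto intro: tendsto_scaleR span_scale)
  then show "c *\<^sub>R u \<in> closure (span S)"
    unfolding closure_sequential by (intro exI[of _ "\<lambda>n. c *\<^sub>R a n"]) auto
qed

instantiation lip_free :: (pointed_metric_space, real_normed_vector) real_normed_vector
begin

lift_definition norm_lip_free :: "('a, 'b) lip_free \<Rightarrow> real" is norm .

lift_definition zero_lip_free :: "('a, 'b) lip_free" is 0
  by (rule subspace_0) (rule subspace_closure_span)

lift_definition plus_lip_free :: "('a, 'b) lip_free \<Rightarrow> ('a, 'b) lip_free \<Rightarrow> ('a, 'b) lip_free" is "(+)"
  by (rule subspace_add) (rule subspace_closure_span)

lift_definition minus_lip_free :: "('a, 'b) lip_free \<Rightarrow> ('a, 'b) lip_free \<Rightarrow> ('a, 'b) lip_free" is "(-)"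
  by (rule subspace_diff) (rule subspace_closure_span)

lift_definition uminus_lip_free :: "('a, 'b) lip_free \<Rightarrow> ('a, 'b) lip_free" is uminus
  by (rule subspace_neg) (rule subspace_closure_span)

lift_definition scaleR_lip_free :: "real \<Rightarrow> ('a, 'b) lip_free \<Rightarrow> ('a, 'b) lip_free" is "(*\<^sub>R)"
  by (rule subspace_scale) (rule subspace_closure_span)

definition dist_lip_free :: "('a, 'b) lip_free \<Rightarrow> ('a, 'b) lip_free \<Rightarrow> real" where
  "dist_lip_free u v = norm (u - v)"

definition uniformity_lip_free :: "(('a, 'b) lip_free \<times> ('a, 'b) lip_free) filter" where
  "uniformity_lip_free = (INF e\<in>{0<..}. principal {(u, v). dist u v < e})"

definition open_lip_free :: "('a, 'b) lip_free set \<Rightarrow> bool" where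
  "open_lip_free S = (\<forall>u\<in>S. \<forall>\<^sub>F (u', v) in uniformity. u' = u \<longrightarrow> v \<in> S)"

definition sgn_lip_free :: "('a, 'b) lip_free \<Rightarrow> ('a, 'b) lip_free" where
  "sgn_lip_free u = inverse (norm u) *\<^sub>R u"

instance
  by standard
    (unfold dist_lip_free_def open_lip_free_def sgn_lip_free_def uniformity_lip_free_def,
     (rule refl | (transfer, force simp: algebra_simps norm_triangle_ineq))+)

end

instance lip_free :: (pointed_metric_space, real_normed_vector) banach
proof
  fix X :: "nat \<Rightarrow> ('a, 'b) lip_free"
  assume X: "Cauchy X"
  have dist_eq: "dist u v = dist (lip_free_functional u) (lip_free_functional v)"
    for u v :: "('a, 'b) lip_free"
    by (simp add: dist_norm norm_lip_free.rep_eq minus_lip_free.rep_eq)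
  have "Cauchy (\<lambda>n. lip_free_functional (X n))"
    using X by (simp add: Cauchy_def dist_eq)
  then obtain l where l: "(\<lambda>n. lip_free_functional (X n)) \<longlonglongrightarrow> l"
    by (auto simp: Cauchy_convergent_iff convergent_def)
  have "l \<in> closure (span {delta m x | m x. True})"
    by (rule closed_sequentially[OF closed_closure lip_free_functional l])
  then have "lip_free_functional (Abs_lip_free l) = l"
    by (rule Abs_lip_free_inverse)
  with l have "X \<longlonglongrightarrow> Abs_lip_free l"
    by (simp add: tendsto_iff dist_eq)
  then show "convergent X"
    by (auto simp: convergent_def)
qed

definition octahedral_norm :: "'e::real_normed_vector itself \<Rightarrow> bool" where
  "octahedral_norm (_ :: 'e itself) \<longleftrightarrow>
     (\<forall>\<epsilon>>0. \<forall>V :: 'e set. subspace V \<and> (\<exists>B. finite B \<and> V = span B) \<longrightarrow>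
        (\<exists>y. norm y = 1 \<and>
           (\<forall>x\<in>V. \<forall>c::real. norm (x + c *\<^sub>R y) \<ge> (1 - \<epsilon>) * (norm x + \<bar>c\<bar>))))"

definition frechet_diff_point :: "'e::real_normed_vector \<Rightarrow> bool" where
  "frechet_diff_point x \<longleftrightarrow>
     (\<exists>D :: 'e \<Rightarrow>\<^sub>L real.
        uniform_limit (sphere 0 1) (\<lambda>(t::real) h. (norm (x + t *\<^sub>R h) - norm x) / t)
          (blinfun_apply D) (at 0))"

end

theory Submission
  imports Defs
begin

text \<open>Elements of a finite-dimensional subspace of \<open>\<F>(M, X)\<close> are approximated, uniformly on the
  sphere, by combinations of evaluations at a finite set \<open>N\<close>. If \<open>M\<close> is unbounded or not uniformly
  discrete, there are points \<open>m \<noteq> n\<close> such that \<open>m\<close> lies almost metrically between \<open>n\<close> and every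
  point of \<open>N\<close>. Hence, for every \<open>f\<close> of norm at most \<open>1\<close>, one may keep \<open>f\<close> on \<open>N \<union> {m}\<close> and set the
  value at \<open>n\<close> to \<open>f m + d(m, n) \<phi>\<close> with a norming functional \<open>\<phi>\<close> at almost no cost in the
  Lipschitz constant; the CPE extends the result to \<open>M\<close>. So the molecule at \<open>(n, m)\<close> is almost
  \<open>\<ell>\<^sub>1\<close>-orthogonal to the subspace. Octahedrality at \<open>span {x}\<close> makes
  \<open>(\<parallel>x + t y\<parallel> + \<parallel>x - t y\<parallel> - 2\<parallel>x\<parallel>) / t\<close> close to \<open>2\<close> for suitable unit vectors \<open>y\<close>, which contradicts
  Frechet differentiability at \<open>x\<close>.\<close>

section \<open>Sublinear functionals and the Hahn-Banach theorem\<close>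

definition sublinear :: "('a::real_vector \<Rightarrow> real) \<Rightarrow> bool" where
  "sublinear p \<longleftrightarrow> (\<forall>x y. p (x + y) \<le> p x + p y) \<and> (\<forall>t x. 0 \<le> t \<longrightarrow> p (t *\<^sub>R x) = t * p x)"

lemma sublinear_add: "sublinear p \<Longrightarrow> p (x + y) \<le> p x + p y"
  and sublinear_scale: "sublinear p \<Longrightarrow> 0 \<le> t \<Longrightarrow> p (t *\<^sub>R x) = t * p x"
  by (auto simp: sublinear_def)

lemma sublinear_zero: "sublinear p \<Longrightarrow> p 0 = 0"
  using sublinear_scale[of p 0 0] by simp

lemma sublinear_minus: "sublinear p \<Longrightarrow> - p (- x) \<le> p x"
  using sublinear_add[of p x "- x"] sublinear_zero[of p] by simp

text \<open>Homogeneity follows from the inequality alone: applied to \<open>inverse t\<close> and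
  \<open>t *\<^sub>R x\<close> it yields the reverse estimate.\<close>

lemma sublinearI:
  assumes "\<And>x y. p (x + y) \<le> p x + p y" and "p 0 = 0"
    and le: "\<And>t x. 0 < t \<Longrightarrow> p (t *\<^sub>R x) \<le> t * p x"
  shows "sublinear p"
  unfolding sublinear_def
proof (intro conjI allI impI)
  fix t :: real and x assume "0 \<le> t"
  show "p (t *\<^sub>R x) = t * p x"
  proof (cases "t = 0")
    case False
    with \<open>0 \<le> t\<close> have t: "0 < t" by simp
    have "p x \<le> inverse t * p (t *\<^sub>R x)"
      using le[of "inverse t" "t *\<^sub>R x"] t by simp
    with t have "t * p x \<le> p (t *\<^sub>R x)"
      by (simp add: field_simps)
    with le[OF t, of x] show ?thesis by simp
  qed (use assms in simp)
qed (use assms in auto)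

text \<open>The functional is q x = inf over t >= 0 of p (x + t y) - t p y. The choice t = 0 gives q
  \<le> p, and t = 1 at the point - y gives the last inequality. A minimal p must therefore be odd,
  and the norm can be lowered to produce norming functionals.\<close>

lemma sublinear_lower:
  assumes p: "sublinear p"
  obtains q where "sublinear q" "q \<le> p" "q (- y) \<le> - p y"
proof
  define A where "A x = (\<lambda>t. p (x + t *\<^sub>R y) - t * p y) ` {0..}" for x
  define q where "q x = Inf (A x)" for x
  have lb: "- p (- x) \<le> a" if "a \<in> A x" for x a
  proof -
    from that obtain t where t: "0 \<le> t" "a = p (x + t *\<^sub>R y) - t * p y"
      by (auto simp: A_def)
    have "p (t *\<^sub>R y) \<le> p (x + t *\<^sub>R y) + p (- x)"
      using sublinear_add[OF p, of "x + t *\<^sub>R y" "- x"] by simp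
    then show ?thesis
      using t sublinear_scale[OF p t(1), of y] by simp
  qed
  have bdd: "bdd_below (A x)" for x
    by (rule bdd_belowI) (rule lb)
  have ne: "A x \<noteq> {}" for x
    by (auto simp: A_def)
  have q_le: "q x \<le> p (x + t *\<^sub>R y) - t * p y" if "0 \<le> t" for x t
    unfolding q_def by (rule cInf_lower[OF _ bdd]) (use that in \<open>auto simp: A_def\<close>)
  have q_ge: "c \<le> q x" if "\<And>t. 0 \<le> t \<Longrightarrow> c \<le> p (x + t *\<^sub>R y) - t * p y" for c x
    unfolding q_def by (rule cInf_greatest[OF ne]) (use that in \<open>auto simp: A_def\<close>)
  show le_p: "q \<le> p"
    using q_le[of 0] by (simp add: le_fun_def)
  show "q (- y) \<le> - p y"
    using q_le[of 1 "- y"] sublinear_zero[OF p] by simp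
  show "sublinear q"
  proof (rule sublinearI)
    fix u v
    \<comment> \<open>The parameters add up: the infimum for u + v is tested at s + t, where p
      splits by subadditivity.\<close>
    have *: "q (u + v) - (p (u + s *\<^sub>R y) - s * p y) \<le> p (v + t *\<^sub>R y) - t * p y"
      if "0 \<le> s" "0 \<le> t" for s t
      using q_le[of "s + t" "u + v"] that
        sublinear_add[OF p, of "u + s *\<^sub>R y" "v + t *\<^sub>R y"]
      by (simp add: algebra_simps)
    have "q (u + v) - q v \<le> p (u + s *\<^sub>R y) - s * p y" if "0 \<le> s" for s
      using q_ge[OF *[OF that]] by simp
    then show "q (u + v) \<le> q u + q v"
      using q_ge[of "q (u + v) - q v" u] by simp
  next
    show "q 0 = 0"
    proof (rule antisym)
      show "q 0 \<le> 0"
        using q_le[of 0 0] sublinear_zero[OF p] by simp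
      show "0 \<le> q 0"
        by (rule q_ge) (simp add: sublinear_scale[OF p])
    qed
  next
    fix t :: real and x assume t: "0 < t"
    have "inverse t * q (t *\<^sub>R x) \<le> p (x + s *\<^sub>R y) - s * p y" if "0 \<le> s" for s
    proof -
      have "q (t *\<^sub>R x) \<le> p (t *\<^sub>R (x + s *\<^sub>R y)) - t * s * p y"
        using q_le[of "t * s" "t *\<^sub>R x"] t that by (simp add: scaleR_add_right)
      also have "\<dots> = t * (p (x + s *\<^sub>R y) - s * p y)"
        using sublinear_scale[OF p, of t "x + s *\<^sub>R y"] t by (simp add: algebra_simps)
      finally show ?thesis
        using t by (simp add: field_simps)
    qed
    then have "inverse t * q (t *\<^sub>R x) \<le> q x"
      by (rule q_ge)
    then show "q (t *\<^sub>R x) \<le> t * q x"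
      using t by (simp add: field_simps)
  qed
qed

text \<open>Hahn-Banach: a minimal sublinear functional is odd by the preceding lemma, hence linear.\<close>

lemma sublinear_dominates_linear:
  fixes p :: "'a::real_vector \<Rightarrow> real"
  assumes p: "sublinear p"
  obtains g where "linear g" "g \<le> p"
proof -
  define S where "S = {q. sublinear q \<and> q \<le> p}"
  \<comment> \<open>Zorn's lemma for the reversed pointwise order, so that a maximal element is a
    minimal sublinear functional below p. The pointwise infimum bounds a nonempty chain; it is
    finite because every sublinear q \<le> p satisfies - p (- x) \<le> q x.\<close>
  have "\<exists>m\<in>S. \<forall>q\<in>S. q \<le> m \<longrightarrow> q = m"
  proof (rule predicate_Zorn[of S "\<lambda>q r. r \<le> q"])
    show "partial_order_on S (relation_of (\<lambda>q r. r \<le> q) S)"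
      by (rule partial_order_on_relation_ofI) auto
  next
    fix C assume C: "C \<in> Chains (relation_of (\<lambda>q r. r \<le> q) S)"
    then have CS: "C \<subseteq> S" and chain: "\<And>q r. q \<in> C \<Longrightarrow> r \<in> C \<Longrightarrow> q \<le> r \<or> r \<le> q"
      by (auto simp: Chains_def relation_of_def)
    show "\<exists>u\<in>S. \<forall>q\<in>C. u \<le> q"
    proof (cases "C = {}")
      case True
      then show ?thesis using p by (auto simp: S_def)
    next
      case False
      define u where "u x = (INF q\<in>C. q x)" for x
      have bdd: "bdd_below ((\<lambda>q. q x) ` C)" for x
      proof (rule bdd_belowI[of _ "- p (- x)"])
        fix a assume "a \<in> (\<lambda>q. q x) ` C"
        then obtain q where q: "sublinear q" "q \<le> p" "a = q x"
          using CS by (auto simp: S_def)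
        show "- p (- x) \<le> a"
          using sublinear_minus[OF q(1), of x] q(2,3) by (auto simp: le_fun_def dest: spec[of _ "- x"])
      qed
      have u_le: "u x \<le> q x" if "q \<in> C" for q x
        unfolding u_def by (rule cINF_lower[OF bdd that])
      have u_ge: "c \<le> u x" if "\<And>q. q \<in> C \<Longrightarrow> c \<le> q x" for c x
        unfolding u_def by (rule cINF_greatest[OF False that])
      have sub: "sublinear q" if "q \<in> C" for q
        using that CS by (auto simp: S_def)
      have "sublinear u"
      proof (rule sublinearI)
        fix x y
        \<comment> \<open>Of two members of the chain, the smaller one can be used at both x and y,
          which allows its own subadditivity to be applied.\<close>
        have *: "u (x + y) - q x \<le> r y" if "q \<in> C" "r \<in> C" for q r
          using chain[OF that]
        proof
          assume "q \<le> r"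
          then have "q y \<le> r y" by (simp add: le_fun_def)
          then show ?thesis
            using u_le[OF that(1), of "x + y"] sublinear_add[OF sub[OF that(1)], of x y] by simp
        next
          assume "r \<le> q"
          then have "r x \<le> q x" by (simp add: le_fun_def)
          then show ?thesis
            using u_le[OF that(2), of "x + y"] sublinear_add[OF sub[OF that(2)], of x y] by simp
        qed
        have "u (x + y) - u y \<le> q x" if "q \<in> C" for q
          using u_ge[of "u (x + y) - q x" y] *[OF that] by force
        then show "u (x + y) \<le> u x + u y"
          using u_ge[of "u (x + y) - u y" x] by simp
      next
        have "(\<lambda>q. q 0) ` C = {0}"
          using False sub sublinear_zero by force
        then show "u 0 = 0" by (simp add: u_def)
      next
        fix t :: real and x assume t: "0 < t"
        have "inverse t * u (t *\<^sub>R x) \<le> q x" if "q \<in> C" for q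
          using u_le[OF that, of "t *\<^sub>R x"] sublinear_scale[OF sub[OF that], of t x] t
          by (simp add: field_simps)
        then have "inverse t * u (t *\<^sub>R x) \<le> u x"
          by (rule u_ge)
        then show "u (t *\<^sub>R x) \<le> t * u x"
          using t by (simp add: field_simps)
      qed
      moreover have "u \<le> p"
      proof -
        obtain q where "q \<in> C" using False by auto
        then have "u \<le> q" "q \<le> p"
          using u_le CS by (auto simp: le_fun_def S_def)
        then show ?thesis by simp
      qed
      ultimately show ?thesis
        using u_le by (auto simp: S_def le_fun_def)
    qed
  qed
  then obtain g where g: "sublinear g" "g \<le> p"
    and min: "\<And>q. sublinear q \<Longrightarrow> q \<le> g \<Longrightarrow> q = g"
    unfolding S_def by (auto intro: order_trans)
  have odd: "g (- x) = - g x" for x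
  proof (rule antisym)
    obtain q where "sublinear q" "q \<le> g" "q (- x) \<le> - g x"
      using sublinear_lower[OF g(1)] by blast
    with min show "g (- x) \<le> - g x" by blast
    show "- g x \<le> g (- x)"
      using sublinear_minus[OF g(1), of x] by simp
  qed
  have "linear g"
  proof (rule linearI)
    fix x y
    have "g (- x + - y) \<le> g (- x) + g (- y)"
      by (rule sublinear_add[OF g(1)])
    moreover have "g (- x + - y) = - g (x + y)"
      using odd[of "x + y"] by (simp add: add.commute)
    ultimately show "g (x + y) = g x + g y"
      using sublinear_add[OF g(1), of x y] by (simp add: odd)
  next
    fix t :: real and x
    show "g (t *\<^sub>R x) = t *\<^sub>R g x"
    proof (cases "0 \<le> t")
      case False
      then have "g ((- t) *\<^sub>R x) = - t * g x"
        by (intro sublinear_scale[OF g(1)]) simp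
      then show ?thesis using odd[of "t *\<^sub>R x"] by simp
    qed (simp add: sublinear_scale[OF g(1)])
  qed
  with g(2) show thesis by (rule that[rotated])
qed

text \<open>Lowering the norm in the direction x before Hahn-Banach forces g (- x) \<le> - norm x,
  which together with g \<le> norm makes g attain norm x at x.\<close>

lemma norming_functional:
  fixes x :: "'a::real_normed_vector"
  obtains \<phi> :: "'a \<Rightarrow>\<^sub>L real" where "norm \<phi> \<le> 1" "\<phi> x = norm x"
proof -
  have "sublinear (norm :: 'a \<Rightarrow> real)"
    by (simp add: sublinear_def norm_triangle_ineq)
  then obtain p where p: "sublinear p" "p \<le> norm" "p (- x) \<le> - norm x"
    by (rule sublinear_lower)
  obtain g where g: "linear g" "g \<le> p"
    using sublinear_dominates_linear[OF p(1)] by blast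
  have le: "g v \<le> norm v" for v
    using g(2) p(2) by (auto simp: le_fun_def intro: order_trans)
  have "\<bar>g v\<bar> \<le> norm v" for v
    using le[of v] le[of "- v"] linear_neg[OF g(1), of v] by simp
  then have g_bd: "norm (g v) \<le> norm v * 1" for v by simp
  then have "bounded_linear g"
    using g(1) by (auto simp: bounded_linear_def bounded_linear_axioms_def intro!: exI[of _ 1])
  then have app: "blinfun_apply (Blinfun g) = g"
    by (rule bounded_linear_Blinfun_apply)
  show thesis
  proof (rule that)
    show "norm (Blinfun g) \<le> 1"
      by (rule norm_blinfun_bound) (use g_bd in \<open>auto simp: app\<close>)
    have "g (- x) \<le> - norm x"
      using g(2) p(3) by (auto simp: le_fun_def intro: order_trans)
    then show "blinfun_apply (Blinfun g) x = norm x"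
      using le[of x] linear_neg[OF g(1), of x] by (simp add: app)
  qed
qed

section \<open>Octahedral norms and Frechet differentiability\<close>

lemma octahedral_norm_not_frechet_diff:
  fixes x :: "'e::real_normed_vector"
  assumes "octahedral_norm TYPE('e)"
  shows "\<not> frechet_diff_point x"
proof
  assume "frechet_diff_point x"
  then obtain D :: "'e \<Rightarrow>\<^sub>L real" where
    D: "uniform_limit (sphere 0 1) (\<lambda>(t::real) h. (norm (x + t *\<^sub>R h) - norm x) / t)
          (blinfun_apply D) (at 0)"
    by (auto simp: frechet_diff_point_def)
  have "\<forall>\<^sub>F t in at (0::real). \<forall>h\<in>sphere 0 1. dist ((norm (x + t *\<^sub>R h) - norm x) / t) (D h) < 1/2"
    using uniform_limitD[OF D, of "1/2"] by simp
  then obtain d where d: "0 < d" and close: "\<And>t h. t \<noteq> 0 \<Longrightarrow> \<bar>t\<bar> < d \<Longrightarrow> norm h = 1 \<Longrightarrow>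
      \<bar>(norm (x + t *\<^sub>R h) - norm x) / t - D h\<bar> < 1/2"
    unfolding eventually_at by (auto simp: dist_real_def)
  define t where "t = d / 2"
  have t: "0 < t" "t < d" using d by (auto simp: t_def)
  \<comment> \<open>With this e the two octahedrality estimates at t and - t add up to at least 2
    norm x + t, their total loss being exactly t. Differentiability with error 1/2 makes the same
    sum strictly smaller, since the terms in D y cancel.\<close>
  define e where "e = t / (2 * (t + norm x))"
  have den: "0 < t + norm x" using t by (simp add: add_pos_nonneg)
  have e: "0 < e" "2 * e * (t + norm x) = t"
    using t den by (simp_all add: e_def nonzero_divide_eq_eq)
  have "subspace (span {x}) \<and> (\<exists>B. finite B \<and> span {x} = span B)"
    by (metis subspace_span finite.emptyI finite_insert)
  then obtain y where y: "norm y = 1"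
    and oct: "\<And>v c. v \<in> span {x} \<Longrightarrow> (1 - e) * (norm v + \<bar>c\<bar>) \<le> norm (v + c *\<^sub>R y)"
    using assms e(1) unfolding octahedral_norm_def by metis
  have x: "x \<in> span {x}" by (simp add: span_base)
  have "(1 - e) * (norm x + t) \<le> norm (x + t *\<^sub>R y)" "(1 - e) * (norm x + t) \<le> norm (x - t *\<^sub>R y)"
    using oct[OF x, of t] oct[OF x, of "- t"] t by auto
  moreover have "norm (x + t *\<^sub>R y) - norm x < (D y + 1/2) * t"
  proof -
    have "(norm (x + t *\<^sub>R y) - norm x) / t < D y + 1/2"
      using close[OF _ _ y, of t] t by linarith
    then show ?thesis using t by (simp only: pos_divide_less_eq)
  qed
  moreover have "norm (x - t *\<^sub>R y) - norm x < (1/2 - D y) * t"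
  proof -
    have "\<bar>- ((norm (x - t *\<^sub>R y) - norm x) / t) - D y\<bar> < 1/2"
      using close[OF _ _ y, of "- t"] t by simp
    then have "(norm (x - t *\<^sub>R y) - norm x) / t < 1/2 - D y" by linarith
    then show ?thesis using t by (simp only: pos_divide_less_eq)
  qed
  ultimately show False
    using e(2) by (simp add: algebra_simps)
qed

section \<open>Approximation of finite-dimensional subspaces\<close>

text \<open>Induction on B. Bounded coordinates make span B closed, so a new vector b0 has positive
  distance d from it. This bounds the coefficient of b0 by norm v / d, and the induction hypothesis
  bounds the others after the b0 component has been subtracted.\<close>

lemma coefficients_bounded:
  fixes B :: "'e::real_normed_vector set"
  assumes "finite B" "independent B"
  obtains K where "0 \<le> K" "\<And>a b. b \<in> B \<Longrightarrow> \<bar>a b\<bar> \<le> K * norm (\<Sum>b\<in>B. a b *\<^sub>R b)"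
proof -
  have "\<exists>K\<ge>0. \<forall>a. \<forall>b\<in>B. \<bar>a b\<bar> \<le> K * norm (\<Sum>b\<in>B. a b *\<^sub>R b)"
    using assms
  proof (induction B rule: finite_induct)
    case empty
    then show ?case by auto
  next
    case (insert b0 B)
    then have b0: "b0 \<notin> span B" and "independent B"
      by (auto simp: independent_insert)
    then obtain K where K: "0 \<le> K" "\<And>a b. b \<in> B \<Longrightarrow> \<bar>a b\<bar> \<le> K * norm (\<Sum>b\<in>B. a b *\<^sub>R b)"
      using insert.IH by blast
    have "b0 \<notin> closure (span B)"
    proof
      assume "b0 \<in> closure (span B)"
      then obtain v where v: "\<And>n. v n \<in> span B" "v \<longlonglongrightarrow> b0"
        unfolding closure_sequential by blast
      have "\<exists>a. v n = (\<Sum>b\<in>B. a b *\<^sub>R b)" for n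
        using v(1)[of n] by (auto simp: span_finite[OF insert.hyps(1)])
      then obtain a where a: "\<And>n. v n = (\<Sum>b\<in>B. a n b *\<^sub>R b)" by metis
      have "\<exists>l. (\<lambda>n. a n b) \<longlonglongrightarrow> l" if b: "b \<in> B" for b
      proof -
        \<comment> \<open>The coefficients of v m - v n are bounded by K times its norm, so
          convergence of v passes to each coordinate.\<close>
        have "Cauchy (\<lambda>n. a n b)"
        proof (rule CauchyI)
          fix e :: real assume e: "0 < e"
          then have "0 < e / (K + 1)" using K(1) by simp
          then obtain M where M: "\<And>m n. m \<ge> M \<Longrightarrow> n \<ge> M \<Longrightarrow> norm (v m - v n) < e / (K + 1)"
            using CauchyD[OF LIMSEQ_imp_Cauchy[OF v(2)]] by metis
          have "norm (a m b - a n b) < e" if "m \<ge> M" "n \<ge> M" for m n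
          proof -
            have "norm (a m b - a n b) \<le> K * norm (v m - v n)"
              using K(2)[OF b, of "\<lambda>b. a m b - a n b"]
              by (simp add: a scaleR_left_diff_distrib sum_subtractf)
            also have "\<dots> \<le> K * (e / (K + 1))"
              using M[OF that] K(1) by (intro mult_left_mono) auto
            also have "\<dots> < e" using K(1) e by (simp add: field_simps)
            finally show ?thesis .
          qed
          then show "\<exists>M. \<forall>m\<ge>M. \<forall>n\<ge>M. norm (a m b - a n b) < e" by blast
        qed
        then show ?thesis by (simp add: Cauchy_convergent_iff convergent_def)
      qed
      then obtain l where "\<And>b. b \<in> B \<Longrightarrow> (\<lambda>n. a n b) \<longlonglongrightarrow> l b" by metis
      then have "v \<longlonglongrightarrow> (\<Sum>b\<in>B. l b *\<^sub>R b)"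
        unfolding a by (intro tendsto_sum tendsto_scaleR tendsto_const) auto
      then have "b0 = (\<Sum>b\<in>B. l b *\<^sub>R b)"
        using v(2) LIMSEQ_unique by blast
      then show False
        using b0 by (simp add: span_sum span_scale span_base)
    qed
    then obtain d where d: "0 < d" and far: "\<And>w. w \<in> span B \<Longrightarrow> d \<le> norm (b0 - w)"
      unfolding closure_approachable by (metis dist_norm dist_commute not_less)
    \<comment> \<open>The summand 1 / d serves the coefficient of b0; the other summand serves the
      rest, because norm w \<le> (1 + norm b0 / d) * norm v.\<close>
    define L where "L = (1 + norm b0 / d) * K + 1 / d"
    have L: "0 \<le> L" using d K(1) by (simp add: L_def)
    have "\<bar>a b\<bar> \<le> L * norm (\<Sum>b\<in>insert b0 B. a b *\<^sub>R b)" if b: "b \<in> insert b0 B" for a b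
    proof -
      define v where "v = (\<Sum>b\<in>insert b0 B. a b *\<^sub>R b)"
      define w where "w = (\<Sum>b\<in>B. a b *\<^sub>R b)"
      have v: "v = a b0 *\<^sub>R b0 + w"
        using insert.hyps by (simp add: v_def w_def)
      have wB: "w \<in> span B"
        by (simp add: w_def span_sum span_scale span_base)
      have a0: "\<bar>a b0\<bar> \<le> norm v / d"
      proof (cases "a b0 = 0")
        case False
        have "d \<le> norm (b0 - (- inverse (a b0)) *\<^sub>R w)"
          by (intro far span_scale wB)
        also have "\<dots> = norm (inverse (a b0) *\<^sub>R v)"
          using False by (simp add: v scaleR_add_right)
        finally show ?thesis
          using False d by (simp add: field_simps)
      qed (use d in simp)
      show ?thesis
      proof (cases "b = b0")
        case True
        have "norm v / d \<le> L * norm v"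
          using K(1) d by (simp add: L_def distrib_right)
        with a0 True show ?thesis by (simp add: v_def)
      next
        case False
        have "norm w \<le> norm v + \<bar>a b0\<bar> * norm b0"
          using norm_triangle_ineq4[of v "a b0 *\<^sub>R b0"] by (simp add: v)
        also have "\<dots> \<le> norm v + norm v / d * norm b0"
          using a0 by (intro add_left_mono mult_right_mono) auto
        finally have "K * norm w \<le> K * (norm v + norm v / d * norm b0)"
          using K(1) by (rule mult_left_mono)
        moreover have "\<bar>a b\<bar> \<le> K * norm w"
          using K(2)[of b a] b False by (simp add: w_def)
        moreover have "K * (norm v + norm v / d * norm b0) \<le> L * norm v"
          using d by (simp add: L_def algebra_simps)
        ultimately show ?thesis by (simp add: v_def)
      qed
    qed
    with L show ?case by blast
  qed
  with that show thesis by blast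
qed

text \<open>Each vector of a basis of the span is perturbed into S. Since coefficients are
  controlled by the norm, the total error is proportional to norm v, uniformly on the
  subspace.\<close>

lemma finite_dim_approx:
  fixes B :: "'e::real_normed_vector set"
  assumes "finite B" "B \<subseteq> closure S" "0 < \<eta>"
  obtains C where "finite C" "C \<subseteq> S" "\<And>v. v \<in> span B \<Longrightarrow> \<exists>w\<in>span C. norm (v - w) \<le> \<eta> * norm v"
proof -
  obtain A where A: "A \<subseteq> B" "independent A" "B \<subseteq> span A"
    using maximal_independent_subset by blast
  have fin: "finite A" using A(1) assms(1) by (rule finite_subset)
  have spanA: "span B \<subseteq> span A" using A(3) by (rule span_minimal) simp
  obtain K where K: "0 \<le> K" "\<And>a b. b \<in> A \<Longrightarrow> \<bar>a b\<bar> \<le> K * norm (\<Sum>b\<in>A. a b *\<^sub>R b)"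
    using coefficients_bounded[OF fin A(2)] by blast
  \<comment> \<open>The accumulated error is at most K * card A * \<delta> * norm v; the 1 keeps the
    denominator positive.\<close>
  define \<delta> where "\<delta> = \<eta> / (K * card A + 1)"
  have pos: "0 < K * card A + 1" using K(1) by (simp add: add_nonneg_pos)
  then have \<delta>: "0 < \<delta>" using assms(3) by (simp add: \<delta>_def)
  have "\<exists>c\<in>S. dist c b < \<delta>" if "b \<in> A" for b
    using that A(1) assms(2) \<delta> by (force simp: closure_approachable)
  then obtain c where c: "\<And>b. b \<in> A \<Longrightarrow> c b \<in> S" "\<And>b. b \<in> A \<Longrightarrow> dist (c b) b < \<delta>" by metis
  show thesis
  proof (rule that)
    show "finite (c ` A)" using fin by simp
    show "c ` A \<subseteq> S" using c(1) by auto
    fix v assume "v \<in> span B"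
    then obtain a where v: "v = (\<Sum>b\<in>A. a b *\<^sub>R b)"
      using spanA by (auto simp: span_finite[OF fin])
    define w where "w = (\<Sum>b\<in>A. a b *\<^sub>R c b)"
    have "norm (v - w) = norm (\<Sum>b\<in>A. a b *\<^sub>R (b - c b))"
      by (simp add: v w_def scaleR_diff_right sum_subtractf)
    also have "\<dots> \<le> (\<Sum>b\<in>A. K * norm v * \<delta>)"
    proof (rule order_trans[OF norm_sum], rule sum_mono)
      fix b assume b: "b \<in> A"
      have "\<bar>a b\<bar> * norm (b - c b) \<le> (K * norm v) * \<delta>"
        using K(2)[OF b, of a] c(2)[OF b] K(1)
        by (intro mult_mono) (auto simp: v dist_norm norm_minus_commute)
      then show "norm (a b *\<^sub>R (b - c b)) \<le> K * norm v * \<delta>" by simp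
    qed
    also have "\<dots> = (K * card A) * \<delta> * norm v" by simp
    also have "\<dots> \<le> \<eta> * norm v"
    proof (rule mult_right_mono)
      have "K * card A * \<delta> \<le> (K * card A + 1) * \<delta>" using \<delta> by (simp add: algebra_simps)
      also have "\<dots> = \<eta>" using pos by (simp add: \<delta>_def)
      finally show "K * card A * \<delta> \<le> \<eta>" .
    qed simp
    finally have "norm (v - w) \<le> \<eta> * norm v" .
    moreover have "w \<in> span (c ` A)"
      unfolding w_def by (intro span_sum span_scale span_base) auto
    ultimately show "\<exists>w\<in>span (c ` A). norm (v - w) \<le> \<eta> * norm v" by blast
  qed
qed

lemma finite_span_finite_support:
  assumes "finite C" "C \<subseteq> span D"
  obtains T where "finite T" "T \<subseteq> D" "C \<subseteq> span T"
proof -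
  have "\<exists>T. finite T \<and> T \<subseteq> D \<and> c \<in> span T" if "c \<in> span D" for c
  proof -
    from that obtain T r where "finite T" "T \<subseteq> D" "c = (\<Sum>a\<in>T. r a *\<^sub>R a)"
      by (auto simp: span_explicit)
    then show ?thesis by (auto intro!: exI[of _ T] intro: span_sum span_scale span_base)
  qed
  then obtain T where T: "\<And>c. c \<in> C \<Longrightarrow> finite (T c) \<and> T c \<subseteq> D \<and> c \<in> span (T c)"
    using assms(2) by (metis subsetD)
  show thesis
  proof (rule that[of "\<Union>c\<in>C. T c"])
    show "C \<subseteq> span (\<Union>c\<in>C. T c)"
    proof
      fix c assume c: "c \<in> C"
      then have "span (T c) \<subseteq> span (\<Union>c\<in>C. T c)" by (intro span_mono) auto
      with T[OF c] show "c \<in> span (\<Union>c\<in>C. T c)" by auto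
    qed
  qed (use T assms(1) in auto)
qed

section \<open>Points almost metrically between another point and a finite set\<close>

text \<open>In an unbounded space m is arbitrary and n lies far away. If some q in N is an
  accumulation point, m = q and n is close to q. Otherwise the points of N are isolated, so a very
  close pair m, n has n away from N and its distance is negligible against d(n, p).\<close>

lemma point_nearly_between_exists:
  fixes N :: "'m::metric_space set"
  assumes "\<not> bounded (UNIV :: 'm set) \<or> \<not> uniform_discrete (UNIV :: 'm set)"
    and fin: "finite N" and \<eta>: "0 < \<eta>"
  obtains m n :: 'm where "m \<noteq> n" "\<And>p. p \<in> N \<Longrightarrow> dist n m + dist m p \<le> (1 + \<eta>) * dist n p"
proof -
  \<comment> \<open>The detour from n to p through m costs at most 2 d(n, m) more than d(n,
    p).\<close>
  have small: "dist n m + dist m p \<le> (1 + \<eta>) * dist n p"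
    if "2 * dist n m \<le> \<eta> * dist n p" for m n p :: 'm
    using that dist_triangle[of m p n] by (simp add: algebra_simps dist_commute)
  consider (unbdd) "\<not> bounded (UNIV :: 'm set)"
    | (lim) q where "q \<in> N" "q islimpt (UNIV :: 'm set)"
    | (iso) "\<And>q. q \<in> N \<Longrightarrow> \<not> q islimpt (UNIV :: 'm set)" "\<not> uniform_discrete (UNIV :: 'm set)"
    using assms(1) by blast
  then show thesis
  proof cases
    case unbdd
    define m :: 'm where "m = (SOME p. True)"
    obtain R where R: "0 < R" "\<And>p. p \<in> N \<Longrightarrow> dist m p \<le> R"
      using bounded_any_center[of N m] finite_imp_bounded[OF fin]
      by (metis less_max_iff_disj max.coboundedI1 zero_less_one)
    \<comment> \<open>This distance makes (2 + \<eta>) d(m, p) \<le> \<eta> d(n, m) on N, which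
      absorbs the error of replacing d(n, m) by d(n, p) + d(m, p).\<close>
    obtain n where n: "dist m n > (2 + \<eta>) * R / \<eta>"
      using unbdd bounded_any_center[of UNIV m] by (force simp: not_le)
    show thesis
    proof (rule that)
      show "m \<noteq> n"
      proof
        assume "m = n"
        moreover have "0 < (2 + \<eta>) * R / \<eta>" using R(1) \<eta> by simp
        ultimately show False using n by simp
      qed
      fix p assume p: "p \<in> N"
      have "(2 + \<eta>) * dist m p \<le> (2 + \<eta>) * R"
        using R(2)[OF p] \<eta> by (intro mult_left_mono) auto
      also have "\<dots> \<le> \<eta> * dist n m"
        using n \<eta> by (simp add: field_simps dist_commute)
      finally have "(2 + \<eta>) * dist m p \<le> \<eta> * dist n m" .
      moreover have "(1 + \<eta>) * dist n m \<le> (1 + \<eta>) * (dist n p + dist m p)"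
        using \<eta> dist_triangle2[of n m p] by (intro mult_left_mono) auto
      ultimately show "dist n m + dist m p \<le> (1 + \<eta>) * dist n p"
        by (simp add: algebra_simps)
    qed
  next
    case lim
    obtain d where d: "0 < d" "\<And>p. p \<in> N - {q} \<Longrightarrow> d \<le> dist q p"
      using finite_set_avoid[OF fin, of q] by (metis Diff_iff singletonI)
    \<comment> \<open>From (2 + \<eta>) d(n, q) \<le> \<eta> d and d \<le> d(n, q) + d(n, p) there
      remains 2 d(n, q) \<le> \<eta> d(n, p), the premise of \<open>small\<close>.\<close>
    define r where "r = \<eta> * d / (2 + \<eta>)"
    have r: "0 < r" using d \<eta> by (simp add: r_def)
    obtain n where n: "n \<noteq> q" "dist n q < r"
      using lim(2) r by (auto simp: islimpt_approachable)
    show thesis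
    proof (rule that[of q n])
      fix p assume p: "p \<in> N"
      show "dist n q + dist q p \<le> (1 + \<eta>) * dist n p"
      proof (cases "p = q")
        case True
        then show ?thesis using \<eta> by (simp add: algebra_simps)
      next
        case False
        then have "d \<le> dist q p" using d p by auto
        also have "\<dots> \<le> dist n q + dist n p" using dist_triangle[of q p n] by (simp add: dist_commute)
        finally have "\<eta> * d \<le> \<eta> * (dist n q + dist n p)"
          using \<eta> by (intro mult_left_mono) auto
        moreover have "(2 + \<eta>) * dist n q \<le> \<eta> * d"
          using n(2) \<eta> by (simp add: r_def field_simps)
        ultimately show ?thesis
          by (intro small) (simp add: algebra_simps)
      qed
    qed (use n in auto)
  next
    case iso
    have "\<exists>r>0. \<forall>n. n \<noteq> q \<longrightarrow> r \<le> dist n q" if "q \<in> N" for q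
      using iso(1)[OF that] by (auto simp: islimpt_approachable not_less)
    then obtain r where r: "\<And>q. q \<in> N \<Longrightarrow> 0 < r q" "\<And>q n. q \<in> N \<Longrightarrow> n \<noteq> q \<Longrightarrow> r q \<le> dist n q"
      by metis
    define s where "s = Min (insert 1 (r ` N))"
    have s: "0 < s" "\<And>q. q \<in> N \<Longrightarrow> s \<le> r q"
      using fin r(1) by (auto simp: s_def)
    \<comment> \<open>The bound s keeps n out of N, and \<eta> * s / 2 provides the premise of
      \<open>small\<close>.\<close>
    define t where "t = min s (\<eta> * s / 2)"
    have "0 < t" using s \<eta> by (simp add: t_def)
    moreover have "\<forall>e>0. \<exists>m n :: 'm. dist m n < e \<and> m \<noteq> n"
      using iso(2) unfolding uniform_discrete_def by simp
    ultimately obtain m n :: 'm where mn: "m \<noteq> n" "dist m n < t"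
      by blast
    have "n \<notin> N"
    proof
      assume n: "n \<in> N"
      have "s \<le> dist m n"
        using s(2)[OF n] r(2)[OF n mn(1)] by linarith
      with mn(2) show False by (simp add: t_def)
    qed
    show thesis
    proof (rule that[OF mn(1)])
      fix p assume p: "p \<in> N"
      with \<open>n \<notin> N\<close> have "n \<noteq> p" by blast
      then have "s \<le> dist n p"
        using s(2)[OF p] r(2)[OF p] by fastforce
      then have "\<eta> * s \<le> \<eta> * dist n p" using \<eta> by simp
      with mn(2) show "dist n m + dist m p \<le> (1 + \<eta>) * dist n p"
        by (intro small) (simp add: t_def dist_commute)
    qed
  qed
qed

section \<open>Pairing with evaluations, extension and almost norming functions\<close>

lemma span_delta_cong:
  fixes F f :: "('m::pointed_metric_space, 'x::real_normed_vector \<Rightarrow>\<^sub>L real) lip"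
  assumes "w \<in> span {delta m x | m x. m \<in> N}"
    and "\<And>p. p \<in> N \<Longrightarrow> lip_apply F p = lip_apply f p"
  shows "blinfun_apply w F = blinfun_apply w f"
  using assms(1)
proof (induction rule: span_induct)
  case base
  show ?case
    by (auto intro!: subspaceI simp: blinfun.add_left blinfun.scaleR_left)
next
  case (step w)
  then show ?case using assms(2) by (auto simp: delta.rep_eq)
qed

lemma CPE_extension:
  fixes f :: "('m::pointed_metric_space, 'z::real_normed_vector) lip"
  assumes "CPE (UNIV :: 'm set) TYPE('z)"
    and f: "norm f \<le> 1" and \<phi>: "norm \<phi> \<le> 1" and \<eta>: "0 < \<eta>" and base: "base_point \<in> N"
    and mn: "m \<noteq> n" "\<And>p. p \<in> N \<Longrightarrow> dist n m + dist m p \<le> (1 + \<eta>) * dist n p"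
  obtains F :: "('m, 'z) lip" where "norm F \<le> 1 + \<eta>"
    "\<forall>p\<in>N. lip_apply F p = lip_apply f p"
    "lip_apply F n - lip_apply F m = dist m n *\<^sub>R \<phi>"
proof -
  define g where "g = (lip_apply f)(n := lip_apply f m + dist m n *\<^sub>R \<phi>)"
  \<comment> \<open>Near-betweenness at p = n would read 2 d(n, m) \<le> 0. Hence overwriting f at n
    leaves its values on N intact.\<close>
  have "n \<notin> N"
  proof
    assume "n \<in> N"
    from mn(2)[OF this] have "dist n m \<le> 0" by (simp add: dist_commute)
    with mn(1) show False by simp
  qed
  have f_le: "norm (lip_apply f p - lip_apply f q) \<le> dist p q" for p q
    using lipschitz_onD[OF lipschitz_on_lip_apply, of p q f] mult_right_mono[OF f zero_le_dist[of p q]]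
    by (simp add: dist_norm)
  have near: "dist n m + dist m p \<le> (1 + \<eta>) * dist n p" if "p \<in> insert m N" for p
    using that mn(2) \<eta> by (auto simp: algebra_simps)
  have n_le: "norm (lip_apply f m + dist m n *\<^sub>R \<phi> - lip_apply f p) \<le> (1 + \<eta>) * dist n p"
    if "p \<in> insert m N" for p
  proof -
    have "norm (lip_apply f m + dist m n *\<^sub>R \<phi> - lip_apply f p)
        \<le> norm (dist m n *\<^sub>R \<phi>) + norm (lip_apply f m - lip_apply f p)"
      using norm_triangle_ineq[of "dist m n *\<^sub>R \<phi>" "lip_apply f m - lip_apply f p"]
      by (simp add: algebra_simps)
    also have "\<dots> \<le> dist n m + dist m p"
      using f_le[of m p] mult_left_mono[OF \<phi> zero_le_dist[of m n]] by (simp add: dist_commute)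
    finally show ?thesis using near[OF that] by simp
  qed
  have lip: "(1 + \<eta>)-lipschitz_on (insert n (insert m N)) g"
  proof (rule lipschitz_onI)
    fix p q assume pq: "p \<in> insert n (insert m N)" "q \<in> insert n (insert m N)"
    consider "p = q" | "p = n" "q \<noteq> n" | "p \<noteq> n" "q = n" | "p \<noteq> n" "q \<noteq> n" by blast
    then show "dist (g p) (g q) \<le> (1 + \<eta>) * dist p q"
    proof cases
      case 2
      then show ?thesis using n_le[of q] pq by (auto simp: g_def dist_norm)
    next
      case 3
      then show ?thesis using n_le[of p] pq by (auto simp: g_def dist_norm dist_commute norm_minus_commute)
    next
      case 4
      have "0 \<le> \<eta> * dist p q" using \<eta> by simp
      with 4 show ?thesis using f_le[of p q] by (simp add: g_def dist_norm algebra_simps)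
    qed simp
  qed (use \<eta> in simp)
  then obtain G where G: "\<exists>L. L-lipschitz_on UNIV G" "\<And>p. p \<in> insert n (insert m N) \<Longrightarrow> G p = g p"
    "lip_const UNIV G = lip_const (insert n (insert m N)) g"
    using assms(1) unfolding CPE_def by (metis subset_UNIV)
  have Gf: "G p = lip_apply f p" if "p \<in> N" for p
    using that G(2)[of p] \<open>n \<notin> N\<close> by (auto simp: g_def)
  \<comment> \<open>The base point lies in N, so the extension vanishes there and is an element of
    the Lipschitz space.\<close>
  have "lip_apply f base_point = 0" by transfer simp
  then have app: "lip_apply (Abs_lip G) = G"
    using Gf[OF base] G(1) by (intro Abs_lip_inverse) simp
  show thesis
  proof (rule that)
    show "norm (Abs_lip G) \<le> 1 + \<eta>"
      using lip_const_le[OF lip] by (simp add: norm_lip.rep_eq app G(3))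
    show "lip_apply (Abs_lip G) n - lip_apply (Abs_lip G) m = dist m n *\<^sub>R \<phi>"
      using G(2)[of n] G(2)[of m] mn(1) by (simp add: app g_def)
  qed (simp add: app Gf)
qed

text \<open>For w \<noteq> 0 the number (1 - \<eta>) * norm w is too small to bound w, so some f
  violates it; f is then normalised and its sign corrected.\<close>

lemma blinfun_almost_norming:
  fixes w :: "'e::real_normed_vector \<Rightarrow>\<^sub>L real"
  assumes "0 < \<eta>" "\<eta> \<le> 1"
  obtains f where "norm f \<le> 1" "(1 - \<eta>) * norm w \<le> w f"
proof (cases "w = 0")
  case True
  then show thesis using that[of 0] by simp
next
  case False
  have "\<exists>f. \<not> norm (w f) \<le> (1 - \<eta>) * norm w * norm f"
  proof (rule ccontr)
    assume "\<nexists>f. \<not> norm (w f) \<le> (1 - \<eta>) * norm w * norm f"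
    then have "norm w \<le> (1 - \<eta>) * norm w"
      using assms by (intro norm_blinfun_bound) auto
    then show False using False assms by (simp add: algebra_simps mult_le_0_iff)
  qed
  then obtain f where f: "(1 - \<eta>) * norm w * norm f < \<bar>w f\<bar>" by (auto simp: not_le)
  then have "f \<noteq> 0" by auto
  define g where "g = (sgn (w f) / norm f) *\<^sub>R f"
  show thesis
  proof (rule that)
    show "norm g \<le> 1" using \<open>f \<noteq> 0\<close> by (simp add: g_def abs_sgn_eq)
    have "w g = \<bar>w f\<bar> / norm f" by (simp add: g_def blinfun.scaleR_right abs_sgn mult.commute)
    with f \<open>f \<noteq> 0\<close> show "(1 - \<eta>) * norm w \<le> w g"
      by (simp add: pos_le_divide_eq)
  qed
qed

lemma linear_lip_free_functional: "linear lip_free_functional"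
  by (rule linearI) (simp_all add: plus_lip_free.rep_eq scaleR_lip_free.rep_eq)

section \<open>Octahedrality of the Lipschitz-free space\<close>

lemma octahedral_norm_lip_free:
  assumes ex: "\<exists>x :: 'x::real_normed_vector. x \<noteq> 0"
    and cpe: "CPE (UNIV :: 'm::pointed_metric_space set) TYPE('x \<Rightarrow>\<^sub>L real)"
    and geo: "\<not> bounded (UNIV :: 'm set) \<or> \<not> uniform_discrete (UNIV :: 'm set)"
  shows "octahedral_norm TYPE(('m, 'x) lip_free)"
  unfolding octahedral_norm_def
proof (intro allI impI)
  fix \<epsilon> :: real and V :: "('m, 'x) lip_free set"
  assume \<epsilon>: "0 < \<epsilon>" and "subspace V \<and> (\<exists>B. finite B \<and> V = span B)"
  then obtain B where B: "finite B" "V = span B" by blast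
  \<comment> \<open>The losses below combine to a factor 1 - 4 \<eta>; the cap 1 keeps 1 - \<eta>
    nonnegative.\<close>
  define \<eta> where "\<eta> = min (\<epsilon> / 4) 1"
  have \<eta>: "0 < \<eta>" "\<eta> \<le> 1" "4 * \<eta> \<le> \<epsilon>" using \<epsilon> by (auto simp: \<eta>_def)
  let ?D = "{delta m x | m x. True} :: (('m, 'x \<Rightarrow>\<^sub>L real) lip \<Rightarrow>\<^sub>L real) set"
  have sub: "lip_free_functional ` B \<subseteq> closure (span ?D)"
    using lip_free_functional by blast
  obtain C where C: "finite C" "C \<subseteq> span ?D"
    and approx: "\<And>v. v \<in> span (lip_free_functional ` B) \<Longrightarrow> \<exists>w\<in>span C. norm (v - w) \<le> \<eta> * norm v"
    by (rule finite_dim_approx[OF finite_imageI[OF B(1)] sub \<eta>(1)]) blast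
  obtain T where T: "finite T" "T \<subseteq> ?D" "C \<subseteq> span T"
    by (rule finite_span_finite_support[OF C])
  have "?D = (\<lambda>(m, x). delta m x) ` UNIV" by auto
  with T obtain P where P: "finite P" "T = (\<lambda>(m, x). delta m x) ` P"
    by (metis finite_subset_image)
  \<comment> \<open>Elements of span C only see a function through its values at these finitely many
    points. The base point is included for the sake of the extension.\<close>
  define N where "N = insert base_point (fst ` P)"
  have "T \<subseteq> {delta m x | m x. m \<in> N}"
    unfolding P(2) N_def by force
  then have spanC: "span C \<subseteq> span {delta m x | m x. m \<in> N}"
    using T(3) by (meson span_minimal span_mono subspace_span subset_trans)
  have N: "finite N" "base_point \<in> N" using P(1) by (auto simp: N_def)
  obtain m n :: 'm where mn: "m \<noteq> n"
    "\<And>p. p \<in> N \<Longrightarrow> dist n m + dist m p \<le> (1 + \<eta>) * dist n p"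
    by (rule point_nearly_between_exists[OF geo N(1) \<eta>(1)]) blast
  obtain x0 :: 'x where "x0 \<noteq> 0" using ex by blast
  define x where "x = sgn x0"
  have x: "norm x = 1" using \<open>x0 \<noteq> 0\<close> by (simp add: x_def norm_sgn)
  obtain \<phi> :: "'x \<Rightarrow>\<^sub>L real" where \<phi>: "norm \<phi> \<le> 1" "\<phi> x = 1"
    using norming_functional[of x] x by metis
  define u where "u = (inverse (dist m n)) *\<^sub>R (delta n x - delta m x)"
  have u_app: "u f = inverse (dist m n) * (lip_apply f n - lip_apply f m) x"
    for f :: "('m, 'x \<Rightarrow>\<^sub>L real) lip"
    by (simp add: u_def blinfun.scaleR_left blinfun.diff_left delta.rep_eq)
  have u_le: "norm u \<le> 1"
  proof (rule norm_blinfun_bound)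
    fix f :: "('m, 'x \<Rightarrow>\<^sub>L real) lip"
    have "norm ((lip_apply f n - lip_apply f m) x) \<le> norm (lip_apply f n - lip_apply f m)"
      using norm_blinfun[of "lip_apply f n - lip_apply f m" x] x by simp
    also have "\<dots> \<le> norm f * dist m n"
      using lipschitz_onD[OF lipschitz_on_lip_apply, of n m f] by (simp add: dist_norm dist_commute)
    finally show "norm (u f) \<le> 1 * norm f"
      using mn(1) by (simp add: u_app abs_mult field_simps)
  qed simp
  \<comment> \<open>Any f in the unit ball can be altered off N so that u takes the value 1,
    whatever f is; this decouples u from span C.\<close>
  have ext: "\<exists>F. norm F \<le> 1 + \<eta> \<and> (\<forall>p\<in>N. lip_apply F p = lip_apply f p) \<and> u F = 1"
    if f: "norm f \<le> 1" for f :: "('m, 'x \<Rightarrow>\<^sub>L real) lip"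
  proof -
    obtain F where F: "norm F \<le> 1 + \<eta>" "\<forall>p\<in>N. lip_apply F p = lip_apply f p"
      "lip_apply F n - lip_apply F m = dist m n *\<^sub>R \<phi>"
      by (rule CPE_extension[OF cpe f \<phi>(1) \<eta>(1) N(2) mn])
    have "u F = 1"
      using mn(1) \<phi>(2) by (simp add: u_app F(3) blinfun.scaleR_left)
    with F(1,2) show ?thesis by blast
  qed
  have "u \<noteq> 0" using ext[of 0] by force
  then have u_pos: "0 < norm u" by simp
  have "u \<in> span ?D"
    unfolding u_def by (intro span_scale span_diff span_base) auto
  \<comment> \<open>The molecule u has norm at most 1, so normalising it to a unit vector can only
    increase its value at F.\<close>
  then have "sgn u \<in> closure (span ?D)"
    unfolding sgn_div_norm by (intro subsetD[OF closure_subset] span_scale)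
  then have y: "lip_free_functional (Abs_lip_free (sgn u)) = sgn u"
    by (rule Abs_lip_free_inverse)
  define y where "y = Abs_lip_free (sgn u)"
  have pos: "(1 - \<epsilon>) * (norm v + c) \<le> norm (v + c *\<^sub>R y)" if v: "v \<in> V" and c: "0 \<le> c" for v c
  proof -
    define v' where "v' = lip_free_functional v"
    have nv: "norm v = norm v'" by (simp add: v'_def norm_lip_free.rep_eq)
    have "v' \<in> span (lip_free_functional ` B)"
      using v by (simp add: v'_def B(2) linear_span_image[OF linear_lip_free_functional])
    then obtain w where w: "w \<in> span C" "norm (v' - w) \<le> \<eta> * norm v'"
      using approx by blast
    obtain f where f: "norm f \<le> 1" "(1 - \<eta>) * norm w \<le> w f"
      by (rule blinfun_almost_norming[OF \<eta>(1,2)])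
    obtain F where F: "norm F \<le> 1 + \<eta>" "\<And>p. p \<in> N \<Longrightarrow> lip_apply F p = lip_apply f p" "u F = 1"
      using ext[OF f(1)] by blast
    have "w F = w f"
      using span_delta_cong[of w N F f] w(1) spanC F(2) by blast
    moreover have "(1 - \<eta>) * ((1 - \<eta>) * norm v') \<le> (1 - \<eta>) * norm w"
    proof (rule mult_left_mono)
      show "(1 - \<eta>) * norm v' \<le> norm w"
        using w(2) norm_triangle_ineq2[of v' w] by (simp add: algebra_simps)
    qed (use \<eta> in simp)
    moreover have "w F - v' F \<le> \<eta> * norm v' * (1 + \<eta>)"
    proof -
      have "w F - v' F \<le> norm ((v' - w) F)" by (simp add: blinfun.diff_left)
      also have "\<dots> \<le> norm (v' - w) * norm F" by (rule norm_blinfun)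
      also have "\<dots> \<le> (\<eta> * norm v') * (1 + \<eta>)"
        using w(2) F(1) \<eta>(1) by (intro mult_mono) auto
      finally show ?thesis .
    qed
    \<comment> \<open>The quadratic terms cancel: (1 - \<eta>)^2 - \<eta> (1 + \<eta>) = 1 - 3
      \<eta>.\<close>
    ultimately have vF: "(1 - 3 * \<eta>) * norm v' \<le> v' F"
      using f(2) by (simp add: algebra_simps)
    have "1 \<le> sgn u F"
      using u_le u_pos F(3) by (simp add: sgn_div_norm blinfun.scaleR_left one_le_inverse_iff)
    then have cF: "c \<le> c * sgn u F" using c mult_left_mono by fastforce
    \<comment> \<open>Dividing by the bound 1 + \<eta> on norm F costs one more \<eta>.\<close>
    have "(1 - 4 * \<eta>) * (norm v' + c) * (1 + \<eta>) \<le> (1 - 3 * \<eta>) * (norm v' + c)"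
    proof -
      have "(1 - 4 * \<eta>) * (1 + \<eta>) \<le> 1 - 3 * \<eta>" by (simp add: algebra_simps)
      then have "(1 - 4 * \<eta>) * (1 + \<eta>) * (norm v' + c) \<le> (1 - 3 * \<eta>) * (norm v' + c)"
        using c by (intro mult_right_mono) auto
      then show ?thesis by (simp add: mult_ac)
    qed
    also have "\<dots> \<le> (1 - 3 * \<eta>) * norm v' + c"
      using c \<eta>(1) by (simp add: algebra_simps)
    also have "\<dots> \<le> (v' + c *\<^sub>R sgn u) F"
      using vF cF by (simp add: blinfun.add_left blinfun.scaleR_left)
    also have "\<dots> \<le> norm (v' + c *\<^sub>R sgn u) * norm F"
      using norm_blinfun[of "v' + c *\<^sub>R sgn u" F] by simp
    also have "\<dots> \<le> norm (v' + c *\<^sub>R sgn u) * (1 + \<eta>)"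
      using F(1) by (intro mult_left_mono) auto
    finally have "(1 - 4 * \<eta>) * (norm v' + c) \<le> norm (v' + c *\<^sub>R sgn u)"
      using \<eta>(1) by (simp add: mult_le_cancel_right)
    moreover have "(1 - \<epsilon>) * (norm v' + c) \<le> (1 - 4 * \<eta>) * (norm v' + c)"
      using \<eta>(3) c by (intro mult_right_mono) auto
    moreover have "norm (v + c *\<^sub>R y) = norm (v' + c *\<^sub>R sgn u)"
      by (simp add: norm_lip_free.rep_eq plus_lip_free.rep_eq scaleR_lip_free.rep_eq v'_def y y_def)
    ultimately show ?thesis by (simp add: nv)
  qed
  show "\<exists>y. norm y = 1 \<and> (\<forall>v\<in>V. \<forall>c. (1 - \<epsilon>) * (norm v + \<bar>c\<bar>) \<le> norm (v + c *\<^sub>R y))"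
  proof (intro exI conjI ballI allI)
    show "norm y = 1"
      using u_pos by (simp add: norm_lip_free.rep_eq y_def y norm_sgn)
    fix v c assume v: "v \<in> V"
    show "(1 - \<epsilon>) * (norm v + \<bar>c\<bar>) \<le> norm (v + c *\<^sub>R y)"
    proof (cases "0 \<le> c")
      case True
      then show ?thesis using pos[OF v] by simp
    next
      \<comment> \<open>Negative scalars reduce to positive ones by changing the sign of the whole
        vector, since V is symmetric.\<close>
      case False
      have "- v \<in> V" using v by (simp add: B(2) span_neg)
      moreover have "norm (- v + (- c) *\<^sub>R y) = norm (v + c *\<^sub>R y)"
        using norm_minus_cancel[of "v + c *\<^sub>R y"] by (simp add: algebra_simps)
      ultimately show ?thesis using pos[of "- v" "- c"] False by simp
    qed
  qed
qed

theorem theorem2p4: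
  assumes "infinite (UNIV :: 'm::pointed_metric_space set)"
    and "\<exists>x :: 'x::banach. x \<noteq> 0"
    and "CPE (UNIV :: 'm set) TYPE('x \<Rightarrow>\<^sub>L real)"
    and "\<not> bounded (UNIV :: 'm set) \<or> \<not> uniform_discrete (UNIV :: 'm set)"
  shows "octahedral_norm TYPE(('m, 'x) lip_free) \<and>
         (\<forall>x \<in> cball (0 :: ('m, 'x) lip_free) 1. \<not> frechet_diff_point x)"
  using octahedral_norm_lip_free[OF assms(2-4)] octahedral_norm_not_frechet_diff by blast

end
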